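(* Let $\beta\in(\tfrac12,1)$ and define $$\rho_{\mathrm{Max}}(\beta)=(1-\sqrt{1-\beta})^2 .$$ Let $r\in(0,1)$ with $r>\rho_{\mathrm{Max}}(\beta)$, and let $\varepsilon_n=n^{-\beta}$, $\mu_n=\sqrt{2r\log(n)}$. Consider a sequence of level-$\alpha_n$ tests that reject $H_0$ when $M_n>m(n,\alpha_n)$, where $M_n=\max_{1\le i\le n}X_i$ and $\alpha_n\to0$ slowly enough. Then $$P_{H_1^{(n)}}\{M_n\text{ rejects }H_0\}\to1,\qquad n\to\infty .$$
   Context: Hypotheses: under $H_0$, $X_1,\dots,X_n$ are i.i.d. $N(0,1)$; under $H_1^{(n)}$, $X_1,\dots,X_n$ are i.i.d. from the mixture $(1-\varepsilon_n)N(0,1)+\varepsilon_nN(\mu_n,1)$. $m(n,\alpha)$ denotes the critical value of the level-$\alpha$ test based on $M_n$, so that $P_{H_0}\{M_n>m(n,\alpha)\}\le\alpha$. One says (for use with $M_n$) that $\alpha_n\to0$ slowly enough if $\alpha_n\to0$ and $m(n,\alpha_n)\sim\sqrt{2\log(n)}$, i.e. the ratio of the two sides tends to $1$ as $n\to\infty$. *)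

theory Defs
  imports "HOL-Probability.Probability" "HOL-Library.Landau_Symbols"
begin

definition mixture_density :: "real \<Rightarrow> real \<Rightarrow> real \<Rightarrow> real" where
  "mixture_density e mu x = (1 - e) * normal_density 0 1 x + e * normal_density mu 1 x"

definition iid_sample :: "'a measure \<Rightarrow> nat \<Rightarrow> (nat \<Rightarrow> 'a \<Rightarrow> real) \<Rightarrow> (real \<Rightarrow> real) \<Rightarrow> bool" where
  "iid_sample P n X f \<longleftrightarrow>
     prob_space P \<and>
     prob_space.indep_vars P (\<lambda>_. borel) X {1..n} \<and>
     (\<forall>i\<in>{1..n}. distributed P lborel (X i) (\<lambda>x. ennreal (f x)))"

definition H0 :: "'a measure \<Rightarrow> nat \<Rightarrow> (nat \<Rightarrow> 'a \<Rightarrow> real) \<Rightarrow> bool" where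
  "H0 P n X \<longleftrightarrow> iid_sample P n X (normal_density 0 1)"

definition H1 :: "'a measure \<Rightarrow> nat \<Rightarrow> (nat \<Rightarrow> 'a \<Rightarrow> real) \<Rightarrow> real \<Rightarrow> real \<Rightarrow> bool" where
  "H1 P n X e mu \<longleftrightarrow> iid_sample P n X (mixture_density e mu)"

text \<open>Only meaningful for \<open>n \<ge> 1\<close>; for \<open>n = 0\<close> it is the unspecified \<open>Max {}\<close>.\<close>

definition max_stat :: "(nat \<Rightarrow> 'a \<Rightarrow> real) \<Rightarrow> nat \<Rightarrow> 'a \<Rightarrow> real" where
  "max_stat X n \<omega> = Max ((\<lambda>i. X i \<omega>) ` {1..n})"

definition reject_prob :: "'a measure \<Rightarrow> (nat \<Rightarrow> 'a \<Rightarrow> real) \<Rightarrow> nat \<Rightarrow> real \<Rightarrow> real" where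
  "reject_prob P X n t = measure P {\<omega> \<in> space P. max_stat X n \<omega> > t}"

text \<open>
  A critical value function for \<open>M\<^sub>n\<close> is any \<open>m\<close> for which the test that rejects when
  \<open>M\<^sub>n > m n a\<close> has level \<open>a\<close>, for every sample size and every level in \<open>(0,1)\<close>. The size
  need not be exactly \<open>a\<close>; the upper \<open>a\<close>-quantile of the null distribution of \<open>M\<^sub>n\<close> is one
  such choice.
\<close>

definition critical_values ::
    "(nat \<Rightarrow> 'a measure) \<Rightarrow> (nat \<Rightarrow> 'a \<Rightarrow> real) \<Rightarrow> (nat \<Rightarrow> real \<Rightarrow> real) \<Rightarrow> bool" where
  "critical_values P0 X m \<longleftrightarrow> (\<forall>n\<ge>1. \<forall>a\<in>{0<..<1}. reject_prob (P0 n) X n (m n a) \<le> a)"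

definition slowly_enough :: "(nat \<Rightarrow> real \<Rightarrow> real) \<Rightarrow> (nat \<Rightarrow> real) \<Rightarrow> bool" where
  "slowly_enough m \<alpha> \<longleftrightarrow>
     \<alpha> \<longlonglongrightarrow> 0 \<and>
     (\<lambda>n. m n (\<alpha> n)) \<sim>[sequentially] (\<lambda>n. sqrt (2 * ln (real n)))"

definition rho_Max :: "real \<Rightarrow> real" where
  "rho_Max \<beta> = (1 - sqrt (1 - \<beta>))\<^sup>2"

end

theory Submission
  imports Defs "HOL-Real_Asymp.Real_Asymp"
begin

text \<open>
  Write \<open>s = sqrt (2 ln n)\<close>. As \<open>1 - sqrt r < sqrt (1 - \<beta>)\<close>, there is a \<open>c\<close> strictly between the
  two; the critical value is eventually below \<open>(c + sqrt r) s\<close>, because \<open>c + sqrt r > 1\<close>.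
  One observation from the mixture exceeds this threshold with probability at least of order
  \<open>n powr (-\<beta>) * exp (- (c s + 1)\<^sup>2 / 2)\<close>, whose product with \<open>n\<close> tends to infinity because
  \<open>c\<^sup>2 < 1 - \<beta>\<close>. By independence the probability that no observation exceeds it tends to \<open>0\<close>.
\<close>

text \<open>The window \<open>{t<..t+1}\<close> has Lebesgue measure 1, so a density that is at
  least \<open>k\<close> on it gives it mass at least \<open>k\<close>. For a Gaussian, such a unit
  window replaces a sharp tail estimate: the loss is of lower order in the exponent.\<close>

lemma (in prob_space) prob_greater_ge:
  fixes X :: "'a \<Rightarrow> real"
  assumes X: "distributed M lborel X (\<lambda>x. ennreal (f x))"
    and k: "0 \<le> k" "\<And>x. t < x \<Longrightarrow> x \<le> t + 1 \<Longrightarrow> k \<le> f x"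
  shows "k \<le> prob {\<omega> \<in> space M. X \<omega> > t}"
proof -
  have meas: "random_variable borel X"
    using distributed_measurable[OF X] by simp
  have "ennreal k = (\<integral>\<^sup>+x. ennreal k * indicator {t<..t+1} x \<partial>lborel)"
    by (simp add: nn_integral_cmult_indicator)
  also have "\<dots> \<le> (\<integral>\<^sup>+x. ennreal (f x) * indicator {t<..t+1} x \<partial>lborel)"
    by (intro nn_integral_mono) (auto simp: indicator_def k(2) intro!: ennreal_leI)
  also have "\<dots> = emeasure M (X -` {t<..t+1} \<inter> space M)"
    by (rule distributed_emeasure[OF X, symmetric]) simp
  also have "\<dots> \<le> emeasure M {\<omega> \<in> space M. X \<omega> > t}"
    using meas by (intro emeasure_mono) auto
  finally show ?thesis
    by (simp add: emeasure_eq_measure)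
qed

text \<open>By independence, the event \<open>A\<close> that no observation exceeds \<open>t\<close>
  has as its probability a product of \<open>n\<close> factors, each at most
  \<open>1 - k \<le> exp (- k)\<close>. The separate \<open>u\<close> lets a critical value known
  only up to an upper bound \<open>t\<close> be treated.\<close>

lemma reject_prob_ge:
  assumes iid: "iid_sample P n X f" and n: "n \<ge> 1"
    and k: "0 \<le> k" "\<And>x. t < x \<Longrightarrow> x \<le> t + 1 \<Longrightarrow> k \<le> f x"
    and ct: "u \<le> t"
  shows "1 - exp (- (real n * k)) \<le> reject_prob P X n u"
proof -
  interpret prob_space P
    using iid by (simp add: iid_sample_def)
  have indep: "indep_vars (\<lambda>_. borel) X {1..n}"
    and dist: "\<And>i. i \<in> {1..n} \<Longrightarrow> distributed P lborel (X i) (\<lambda>x. ennreal (f x))"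
    using iid by (auto simp: iid_sample_def)
  have meas[measurable]: "random_variable borel (X i)" if "i \<in> {1..n}" for i
    using distributed_measurable[OF dist[OF that]] by simp
  define A where "A = (\<Inter>i\<in>{1..n}. X i -` {..t} \<inter> space P)"
  have A_sets: "A \<in> events"
    unfolding A_def using n meas by (intro sets.finite_INT) (auto intro: measurable_sets)
  have le: "prob (X i -` {..t} \<inter> space P) \<le> exp (- k)" if i: "i \<in> {1..n}" for i
  proof -
    have "X i -` {..t} \<inter> space P = space P - {\<omega> \<in> space P. X i \<omega> > t}"
      by auto
    moreover have "{\<omega> \<in> space P. X i \<omega> > t} \<in> events"
      using meas[OF i] by measurable
    ultimately have "prob (X i -` {..t} \<inter> space P) = 1 - prob {\<omega> \<in> space P. X i \<omega> > t}"
      by (simp add: prob_compl)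
    also have "\<dots> \<le> 1 - k"
      using prob_greater_ge[OF dist[OF i] k] by simp
    also have "\<dots> \<le> exp (- k)"
      using exp_ge_add_one_self[of "- k"] by simp
    finally show ?thesis .
  qed
  have "prob A = (\<Prod>i\<in>{1..n}. prob (X i -` {..t} \<inter> space P))"
    unfolding A_def using n by (intro indep_varsD[OF indep]) auto
  also have "\<dots> \<le> (\<Prod>i\<in>{1..n}. exp (- k))"
    by (intro prod_mono conjI le) auto
  also have "\<dots> = exp (- (real n * k))"
    by (simp add: exp_of_nat_mult[symmetric])
  finally have "1 - exp (- (real n * k)) \<le> prob (space P - A)"
    using A_sets by (simp add: prob_compl)
  also have "\<dots> \<le> prob {\<omega> \<in> space P. max_stat X n \<omega> > u}"
  proof (rule finite_measure_mono)
    show "space P - A \<subseteq> {\<omega> \<in> space P. max_stat X n \<omega> > u}"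
    proof
      fix \<omega> assume \<omega>: "\<omega> \<in> space P - A"
      then obtain i where i: "i \<in> {1..n}" "X i \<omega> > t"
        using n by (auto simp: A_def not_le split: if_splits)
      then have "t < max_stat X n \<omega>"
        unfolding max_stat_def by (subst Max_gr_iff) auto
      with \<omega> ct show "\<omega> \<in> {\<omega> \<in> space P. max_stat X n \<omega> > u}"
        by auto
    qed
    \<comment> \<open>Monotonicity of the measure needs the larger set to be an event; writing it as
      a finite union reduces this to the single observations.\<close>
    have "{\<omega> \<in> space P. max_stat X n \<omega> > u} = (\<Union>i\<in>{1..n}. {\<omega> \<in> space P. X i \<omega> > u})"
      using n by (auto simp: max_stat_def Max_gr_iff)
    also have "\<dots> \<in> events"
      using meas by (intro sets.finite_UN) auto
    finally show "{\<omega> \<in> space P. max_stat X n \<omega> > u} \<in> events" .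
  qed
  finally show ?thesis
    by (simp add: reject_prob_def)
qed

text \<open>The null component is dropped. To the right of its mean the shifted normal density
  decreases, so on the window it is smallest at \<open>t + 1\<close>.\<close>

lemma mixture_density_ge:
  assumes "0 \<le> e" "e \<le> 1" "mu \<le> t" "t < x" "x \<le> t + 1"
  shows "e * exp (- (t + 1 - mu)\<^sup>2 / 2) / sqrt (2 * pi) \<le> mixture_density e mu x"
proof -
  have "(x - mu)\<^sup>2 \<le> (t + 1 - mu)\<^sup>2"
    using assms by (intro power_mono) auto
  then have "exp (- (t + 1 - mu)\<^sup>2 / 2) / sqrt (2 * pi) \<le> normal_density mu 1 x"
    by (simp add: normal_density_def divide_right_mono)
  then have "e * (exp (- (t + 1 - mu)\<^sup>2 / 2) / sqrt (2 * pi)) \<le> e * normal_density mu 1 x"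
    using assms(1) by (rule mult_left_mono)
  moreover have "0 \<le> (1 - e) * normal_density 0 1 x"
    using assms(2) by simp
  ultimately show ?thesis
    by (simp add: mixture_density_def)
qed

lemma filterlim_sqrt_2_ln: "filterlim (\<lambda>n. sqrt (2 * ln (real n))) at_top sequentially"
  by real_asymp

text \<open>With \<open>s = sqrt (2 * ln n)\<close> one has \<open>n = exp (s\<^sup>2 / 2)\<close>,
  so the whole expression is the exponential of a quadratic in \<open>s\<close> whose leading
  coefficient \<open>(1 - \<beta> - c\<^sup>2) / 2\<close> is positive.\<close>

lemma expected_exceedances_at_top:
  fixes \<beta> c :: real
  assumes "c\<^sup>2 < 1 - \<beta>"
  shows "filterlim (\<lambda>n. real n * (real n powr - \<beta> *
           exp (- (c * sqrt (2 * ln (real n)) + 1)\<^sup>2 / 2) / sqrt (2 * pi))) at_top sequentially"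
proof -
  define a where "a = 1 - \<beta> - c\<^sup>2"
  have a: "a > 0"
    using assms by (simp add: a_def)
  have "filterlim (\<lambda>s. exp ((a * s\<^sup>2 - 2 * c * s - 1) / 2) / sqrt (2 * pi)) at_top at_top"
    using a by real_asymp
  from filterlim_compose[OF this filterlim_sqrt_2_ln]
  have "filterlim (\<lambda>n. exp ((a * (sqrt (2 * ln (real n)))\<^sup>2 - 2 * c * sqrt (2 * ln (real n)) - 1) / 2)
          / sqrt (2 * pi)) at_top sequentially" .
  moreover have "\<forall>\<^sub>F n in sequentially.
      exp ((a * (sqrt (2 * ln (real n)))\<^sup>2 - 2 * c * sqrt (2 * ln (real n)) - 1) / 2) / sqrt (2 * pi)
      = real n * (real n powr - \<beta> *
           exp (- (c * sqrt (2 * ln (real n)) + 1)\<^sup>2 / 2) / sqrt (2 * pi))"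
    using eventually_ge_at_top[of 1]
  proof eventually_elim
    case (elim n)
    define s where "s = sqrt (2 * ln (real n))"
    \<comment> \<open>The bound \<open>n \<ge> 1\<close> makes the radicand nonnegative.\<close>
    have s: "s\<^sup>2 = 2 * ln (real n)"
      using elim by (simp add: s_def)
    have "real n * real n powr - \<beta> = exp (ln (real n) + - \<beta> * ln (real n))"
      unfolding exp_add using elim by (simp add: powr_def)
    also have "\<dots> = exp ((1 - \<beta>) * s\<^sup>2 / 2)"
      by (simp add: s algebra_simps)
    finally have "real n * real n powr - \<beta> * exp (- (c * s + 1)\<^sup>2 / 2)
        = exp ((1 - \<beta>) * s\<^sup>2 / 2 + - (c * s + 1)\<^sup>2 / 2)"
      by (simp only: exp_add)
    also have "(1 - \<beta>) * s\<^sup>2 / 2 + - (c * s + 1)\<^sup>2 / 2 = (a * s\<^sup>2 - 2 * c * s - 1) / 2"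
      by (simp add: a_def field_simps power2_eq_square)
    finally show ?case
      by (simp add: s_def mult.assoc)
  qed
  ultimately show ?thesis
    by (simp cong: filterlim_cong)
qed

lemma asymp_equiv_sqrt_2_ln_eventually_le:
  assumes "f \<sim>[sequentially] (\<lambda>n. sqrt (2 * ln (real n)))" "1 < d"
  shows "\<forall>\<^sub>F n in sequentially. f n \<le> d * sqrt (2 * ln (real n))"
proof -
  \<comment> \<open>Asymptotic equivalence is defined with the convention 0/0 = 1. From
    \<open>n = 2\<close> on the denominator is positive, and the plain quotient remains.\<close>
  have "\<forall>\<^sub>F n in sequentially. (if f n = 0 \<and> sqrt (2 * ln (real n)) = 0 then 1
          else f n / sqrt (2 * ln (real n))) < d"
    using assms unfolding asymp_equiv_def by (rule order_tendstoD)
  with eventually_ge_at_top[of 2] show ?thesis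
  proof eventually_elim
    case (elim n)
    then have "sqrt (2 * ln (real n)) > 0"
      by simp
    with elim(2) show ?case
      by (auto simp: field_simps split: if_splits)
  qed
qed

theorem theorem1p3:
  fixes \<beta> r :: real
    and \<epsilon> \<mu> \<alpha> :: "nat \<Rightarrow> real"
    and P0 P1 :: "nat \<Rightarrow> 'a measure"
    and X :: "nat \<Rightarrow> 'a \<Rightarrow> real"
    and m :: "nat \<Rightarrow> real \<Rightarrow> real"
  assumes "1/2 < \<beta>" and "\<beta> < 1"
    and "0 < r" and "r < 1" and "r > rho_Max \<beta>"
    and "\<And>n. n \<ge> 1 \<Longrightarrow> \<epsilon> n = real n powr (- \<beta>)"
    and "\<And>n. n \<ge> 1 \<Longrightarrow> \<mu> n = sqrt (2 * r * ln (real n))"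
    and "\<And>n. n \<ge> 1 \<Longrightarrow> H0 (P0 n) n X"
    and "\<And>n. n \<ge> 1 \<Longrightarrow> H1 (P1 n) n X (\<epsilon> n) (\<mu> n)"
    and "critical_values P0 X m"
    and "\<And>n. n \<ge> 1 \<Longrightarrow> 0 < \<alpha> n \<and> \<alpha> n < 1"
    and "slowly_enough m \<alpha>"
  shows "(\<lambda>n. reject_prob (P1 n) X n (m n (\<alpha> n))) \<longlonglongrightarrow> 1"
proof -
  \<comment> \<open>The square of the left side is \<open>rho_Max \<beta>\<close>.\<close>
  have "1 - sqrt (1 - \<beta>) < sqrt r"
    using \<open>r > rho_Max \<beta>\<close> by (intro real_less_rsqrt) (simp add: rho_Max_def)
  then obtain c where c: "1 - sqrt r < c" "c < sqrt (1 - \<beta>)"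
    using dense[of "1 - sqrt r" "sqrt (1 - \<beta>)"] by auto
  \<comment> \<open>Positivity of \<open>c\<close> permits squaring
    \<open>c < sqrt (1 - \<beta>)\<close> and later places the threshold to the right of the mean
    \<open>\<mu> n\<close>.\<close>
  have "sqrt r < 1"
    using \<open>r < 1\<close> by simp
  with c(1) have "c > 0"
    by linarith
  then have "c\<^sup>2 < (sqrt (1 - \<beta>))\<^sup>2"
    using c by (intro power_strict_mono) auto
  then have c2: "c\<^sup>2 < 1 - \<beta>"
    using \<open>\<beta> < 1\<close> by simp
  \<comment> \<open>This is the bound of \<open>mixture_density_ge\<close> at the threshold
    \<open>t = (c + sqrt r) * s\<close>, whose distance from \<open>\<mu> n = sqrt r * s\<close> is
    \<open>c * s\<close>.\<close>
  define k where "k = (\<lambda>n. real n powr - \<beta> *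
    exp (- (c * sqrt (2 * ln (real n)) + 1)\<^sup>2 / 2) / sqrt (2 * pi))"
  have "filterlim (\<lambda>n. real n * k n) at_top sequentially"
    unfolding k_def by (rule expected_exceedances_at_top[OF c2])
  then have "(\<lambda>n. exp (- (real n * k n))) \<longlonglongrightarrow> 0"
    by (intro filterlim_compose[OF exp_at_bot] filterlim_compose[OF filterlim_uminus_at_bot_at_top])
  then have lim: "(\<lambda>n. 1 - exp (- (real n * k n))) \<longlonglongrightarrow> 1"
    using tendsto_diff[OF tendsto_const[of 1]] by fastforce
  have "(\<lambda>n. m n (\<alpha> n)) \<sim>[sequentially] (\<lambda>n. sqrt (2 * ln (real n)))"
    using \<open>slowly_enough m \<alpha>\<close> by (simp add: slowly_enough_def)
  then have "\<forall>\<^sub>F n in sequentially. m n (\<alpha> n) \<le> (c + sqrt r) * sqrt (2 * ln (real n))"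
    using c by (intro asymp_equiv_sqrt_2_ln_eventually_le) auto
  with eventually_ge_at_top[of 1]
  have lower: "\<forall>\<^sub>F n in sequentially.
      1 - exp (- (real n * k n)) \<le> reject_prob (P1 n) X n (m n (\<alpha> n))"
  proof eventually_elim
    case (elim n)
    define s where "s = sqrt (2 * ln (real n))"
    have s: "s \<ge> 0" and \<mu>: "\<mu> n = sqrt r * s" and e: "\<epsilon> n = real n powr - \<beta>"
      using elim assms(6,7)[of n] by (simp_all add: s_def real_sqrt_mult)
    have e1: "0 \<le> \<epsilon> n" "\<epsilon> n \<le> 1"
      using elim \<open>1/2 < \<beta>\<close> by (simp_all add: e powr_minus inverse_le_1_iff ge_one_powr_ge_zero)
    have k_le: "k n \<le> mixture_density (\<epsilon> n) (\<mu> n) x"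
      if "(c + sqrt r) * s < x" "x \<le> (c + sqrt r) * s + 1" for x
      using mixture_density_ge[OF e1 _ that, of "\<mu> n"] s \<open>c > 0\<close>
      by (simp add: k_def e \<mu> s_def[symmetric] algebra_simps)
    show ?case
      using assms(9)[of n] elim k_le unfolding H1_def
      by (intro reject_prob_ge[where t = "(c + sqrt r) * s"]) (auto simp: s_def k_def)
  qed
  have upper: "\<forall>\<^sub>F n in sequentially. reject_prob (P1 n) X n (m n (\<alpha> n)) \<le> 1"
    using eventually_ge_at_top[of 1]
  proof eventually_elim
    case (elim n)
    then interpret prob_space "P1 n"
      using assms(9)[of n] by (simp add: H1_def iid_sample_def)
    show ?case
      by (simp add: reject_prob_def)
  qed
  show ?thesis
    by (rule tendsto_sandwich[OF lower upper lim tendsto_const])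
qed

end
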